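(* Let $\mathcal{P}$ be a prior (probability) distribution over a measurable space $(\Theta,\mathcal{G})$, and let $\nu$ and $\{\mu_\theta\}_{\theta\in\Theta}$ be finite measures over a measurable space $(\mathcal{X},\mathcal{F})$. Let $\mathcal{A}$ be an action space, let $\mathfrak{A}$ be the space of (measurable) decision rules $\mathfrak{a}:\mathcal{X}\to\mathcal{A}$, and let $\mathcal{I}:\mathcal{A}\times\Theta\to\{0,1\}$ be an indicator function. Define $$V_0:=\sup_{a\in\mathcal{A}}\Pr_{\theta\sim\mathcal{P}}[\mathcal{I}(a,\theta)=1],\qquad V_{\mathrm{opt}}:=\sup_{\mathfrak{a}\in\mathfrak{A}}\mathbb{E}_{\theta\sim\mathcal{P}}\,\mu_\theta\big(\{x:\mathcal{I}(\mathfrak{a}(x),\theta)=1\}\big).$$ Suppose $f$ is non-negative and convex, $\nu(\mathcal{X})\le1$, $\sup_{\theta\in\Theta}\mu_\theta(\mathcal{X})\le1$, $\mu_\theta$ is absolutely continuous with respect to $\nu$ for all $\theta\in\Theta$, and either (i) $x\mapsto xf(1/x)$ is non-increasing, or (ii) $\nu(\mathcal{X})=1$. Then $$\mathbb{E}_{\theta\sim\mathcal{P}}\,\mathbb{E}_\nu\left[f\left(\frac{\mathrm{d}\mu_\theta}{\mathrm{d}\nu}\right)\right]\ \ge\ V_0\,f\left(\frac{V_{\mathrm{opt}}}{V_0}\right).$$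
   Context: The measures are not required to be normalized. $\mathbb{E}_\nu[h]$ denotes $\int h\,\mathrm{d}\nu$. $f$ is a function on $(0,\infty)$ with $f(0):=\lim_{t\to0^+}f(t)$. The right-hand side is read for $V_0>0$. The usual joint measurability (of $(\theta,x)\mapsto \frac{\mathrm d\mu_\theta}{\mathrm d\nu}(x)$, of $\theta\mapsto\mu_\theta(A)$, and of $(\theta,x)\mapsto\mathcal{I}(\mathfrak{a}(x),\theta)$) is implicit. *)

theory Defs
  imports "HOL-Probability.Probability"
begin

text \<open>
  A real function \<open>f\<close> on \<open>(0, \<infinity>)\<close>, extended by \<open>f(0) = lim f(t)\<close> for \<open>t \<rightarrow> 0+\<close>. The values are
  in \<open>ennreal\<close> because this limit may be infinite even for a non-negative convex \<open>f\<close>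
  (e.g. \<open>f(t) = 1/t\<close>). The argument is in \<open>ennreal\<close> to match \<^const>\<open>RN_deriv\<close>; the value at
  \<open>\<infinity>\<close> is a dummy, since the densities of finite measures are almost everywhere finite.
\<close>
definition ext0 :: "(real \<Rightarrow> real) \<Rightarrow> ennreal \<Rightarrow> ennreal" where
  "ext0 f t = (if t = 0 then Lim (at_right 0) (\<lambda>s. ennreal (f s)) else ennreal (f (enn2real t)))"

text \<open>The action space is a measurable space, given by a measure of which only the
  carrier and the sigma-algebra are used.\<close>
definition V0 :: "'t measure \<Rightarrow> 'a measure \<Rightarrow> ('a \<Rightarrow> 't \<Rightarrow> real) \<Rightarrow> ennreal" where
  "V0 P A I = (SUP a\<in>space A. emeasure P {\<theta> \<in> space P. I a \<theta> = 1})"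

definition decision_rules :: "'x measure \<Rightarrow> 'a measure \<Rightarrow> ('x \<Rightarrow> 'a) set" where
  "decision_rules X A = measurable X A"

definition Vopt ::
  "'t measure \<Rightarrow> 'x measure \<Rightarrow> ('t \<Rightarrow> 'x measure) \<Rightarrow> 'a measure \<Rightarrow> ('a \<Rightarrow> 't \<Rightarrow> real) \<Rightarrow> ennreal" where
  "Vopt P X \<mu> A I =
     (SUP d\<in>decision_rules X A. \<integral>\<^sup>+\<theta>. emeasure (\<mu> \<theta>) {x \<in> space X. I (d x) \<theta> = 1} \<partial>P)"

end

theory Submission
  imports Defs
begin

text \<open>
  Let \<open>b + c t\<close> be a tangent to \<open>f\<close> at \<open>Vopt / V0\<close> and let \<open>L\<close> be the integral of \<open>f\<close> over the
  densities. As \<open>f \<ge> 0\<close>, for every measurable \<open>W\<close> in the product space \<open>L \<ge> b p + c q\<close>, where \<open>p\<close> and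
  \<open>q\<close> are the masses of \<open>W\<close> under the product of the prior with \<open>\<nu>\<close> and with the \<open>\<mu> \<theta>\<close>. The goal
  is \<open>L \<ge> b V0 + c Vopt\<close>. If \<open>b \<le> 0\<close>, take for \<open>W\<close> the success set of a decision rule, as then
  \<open>p \<le> V0\<close>, and let \<open>q\<close> tend to \<open>Vopt\<close>; hypothesis (i) forces this case. Otherwise \<open>\<nu>\<close> has mass 1: if
  \<open>c \<ge> 0\<close>, take the whole space, with \<open>p = 1 \<ge> V0\<close> and \<open>q \<ge> Vopt\<close>; if \<open>c < 0\<close>, take constant
  decision rules, for which \<open>q \<le> Vopt\<close> and \<open>p\<close> has supremum \<open>V0\<close>.
\<close>

section \<open>Extension of a convex function to 0: existence of the limit, measurability, affine
  bounds\<close>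

text \<open>The middle value is at most a weighted mean of the outer ones, so if it exceeds the left
  one, the right one must exceed it.\<close>

lemma convex_on_strict_increase:
  fixes f :: "real \<Rightarrow> real"
  assumes "convex_on S f" "x \<in> S" "z \<in> S" "x < y" "y < z" "f x < f y"
  shows "f y < f z"
proof -
  define t where "t = (y - x) / (z - x)"
  have t: "0 < t" "t < 1" using assms by (auto simp: t_def)
  have "t * (z - x) = y - x" using assms by (simp add: t_def)
  then have "(1 - t) *\<^sub>R x + t *\<^sub>R z = y" by (simp add: algebra_simps)
  with convex_onD[OF assms(1), of t x z] t assms have "f y \<le> (1 - t) * f x + t * f z" by simp
  also have "\<dots> < (1 - t) * f y + t * f z" using t assms by simp
  finally have "t * f y < t * f z" by (simp add: algebra_simps)
  then show ?thesis using t by simp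
qed

lemma tendsto_at_right_SUP:
  fixes g :: "real \<Rightarrow> ennreal"
  assumes "a < e" and anti: "\<And>x y. a < x \<Longrightarrow> x \<le> y \<Longrightarrow> y < e \<Longrightarrow> g y \<le> g x"
  shows "(g \<longlongrightarrow> (SUP x\<in>{a<..<e}. g x)) (at_right a)"
proof (rule order_tendstoI)
  fix l assume "l < (SUP x\<in>{a<..<e}. g x)"
  then obtain x where x: "a < x" "x < e" "l < g x" by (auto simp: less_SUP_iff)
  show "\<forall>\<^sub>F y in at_right a. l < g y"
    unfolding eventually_at_right_field
    by (rule exI[of _ x]) (use x anti in \<open>auto intro: less_le_trans\<close>)
next
  fix l assume l: "(SUP x\<in>{a<..<e}. g x) < l"
  have "g y < l" if "a < y" "y < e" for y
    using that by (intro le_less_trans[OF SUP_upper l]) auto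
  then show "\<forall>\<^sub>F y in at_right a. g y < l"
    unfolding eventually_at_right_field using \<open>a < e\<close> by blast
qed

text \<open>Either \<open>f\<close> is non-increasing near 0 and the limit is a supremum, or
  increases occur arbitrarily close to 0; convexity then makes \<open>f\<close> increasing
  throughout, and the limit is an infimum. This gives the \<open>Lim\<close> in \<open>ext0\<close>
  its intended meaning.\<close>

lemma convex_on_tendsto_at_right_0:
  fixes f :: "real \<Rightarrow> real"
  assumes conv: "convex_on {0<..} f"
  shows "\<exists>l. ((\<lambda>s. ennreal (f s)) \<longlongrightarrow> l) (at_right 0)"
proof (cases "\<exists>e>0. \<forall>x y. 0 < x \<longrightarrow> x \<le> y \<longrightarrow> y < e \<longrightarrow> f y \<le> f x")
  case True
  then obtain e where "e > 0" "\<And>x y. 0 < x \<Longrightarrow> x \<le> y \<Longrightarrow> y < e \<Longrightarrow> f y \<le> f x" by blast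
  then have "((\<lambda>s. ennreal (f s)) \<longlongrightarrow> (SUP s\<in>{0<..<e}. ennreal (f s))) (at_right 0)"
    by (intro tendsto_at_right_SUP) (auto intro: ennreal_leI)
  then show ?thesis by blast
next
  case False
  have mono: "f u \<le> f v" if uv: "0 < u" "u \<le> v" for u v
  proof (cases "u = v")
    case neq: False
    \<comment> \<open>An increase to the left of \<open>u\<close> propagates first to
      \<open>u\<close> and from there to \<open>v\<close>.\<close>
    from False \<open>0 < u\<close> obtain x y where xy: "0 < x" "x \<le> y" "y < u" "f x < f y"
      by (meson not_le)
    then have "x < y" by (cases "x = y") auto
    then have "f y < f u" using convex_on_strict_increase[OF conv, of x u y] xy uv by auto
    then have "f u < f v" using convex_on_strict_increase[OF conv, of y v u] xy uv neq by auto
    then show ?thesis by simp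
  qed simp
  have "((\<lambda>s. ennreal (f s)) \<longlongrightarrow> Inf ((\<lambda>s. ennreal (f s)) ` ({0<..} \<inter> UNIV)))
      (at 0 within ({0<..} \<inter> UNIV))"
    by (rule Lim_right_bound[where K = 0]) (auto intro: ennreal_leI mono)
  then show ?thesis by auto
qed

lemma tendsto_ext0_0:
  assumes "convex_on {0<..} f"
  shows "((\<lambda>s. ennreal (f s)) \<longlongrightarrow> ext0 f 0) (at_right 0)"
  using convex_on_tendsto_at_right_0[OF assms] by (auto simp: ext0_def tendsto_Lim)

lemma borel_measurable_ext0:
  assumes "convex_on {0<..} f"
  shows "ext0 f \<in> borel_measurable borel"
proof -
  have "continuous_on {0<..} f" using assms by (intro convex_on_continuous) auto
  then have f: "(\<lambda>t. f t * indicator {0<..} t) \<in> borel_measurable borel"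
    using borel_measurable_continuous_on_indicator[of "{0<..}" f] by (simp add: mult.commute)
  \<comment> \<open>As \<open>enn2real \<top> = 0\<close>, the value at \<open>\<top>\<close> is
    \<open>ennreal (f 0)\<close>, which is arbitrary and has to be split off from the continuous
    part.\<close>
  have "ext0 f = (\<lambda>t. if t = 0 then ext0 f 0
      else if t = \<top> then ennreal (f 0) else ennreal (f (enn2real t) * indicator {0<..} (enn2real t)))"
    by (auto simp: fun_eq_iff ext0_def indicator_def enn2real_positive_iff less_top zero_less_iff_neq_zero)
  moreover have "\<dots> \<in> borel_measurable borel"
    using measurable_compose[OF borel_measurable_enn2real[OF measurable_ident_sets[OF refl]] f] by measurable
  ultimately show ?thesis by simp
qed

text \<open>Truncation of \<^const>\<open>ennreal\<close> at 0 splits both coefficients of the affine minorant into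
  positive and negative parts.\<close>
lemma affine_le_ext0:
  assumes conv: "convex_on {0<..} f" and le: "\<And>s. 0 < s \<Longrightarrow> b + c * s \<le> f s" and t: "t \<noteq> \<top>"
  shows "ennreal b + ennreal c * t \<le> ext0 f t + ennreal (- b) + ennreal (- c) * t"
proof (cases "t = 0")
  case True
  have "((\<lambda>s. ennreal (b + c * s)) \<longlongrightarrow> ennreal (b + c * 0)) (at_right 0)"
    by (intro tendsto_intros)
  moreover have "\<forall>\<^sub>F s in at_right 0. ennreal (b + c * s) \<le> ennreal (f s)"
    by (auto simp: eventually_at_right_field intro!: ennreal_leI le exI[of _ 1])
  ultimately have "ennreal b \<le> ext0 f 0"
    using tendsto_le[OF _ tendsto_ext0_0[OF conv]] by fastforce
  then show ?thesis using True by (simp add: add_increasing2)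
next
  case False
  define s where "s = enn2real t"
  have s: "t = ennreal s" "s > 0"
    using t False by (auto simp: s_def enn2real_positive_iff less_top zero_less_iff_neq_zero)
  have "max 0 b + max 0 c * s \<le> max 0 (f s) + max 0 (- b) + max 0 (- c) * s"
    using le[OF \<open>s > 0\<close>] by (auto simp: max_def algebra_simps)
  then have "ennreal (max 0 b + max 0 c * s) \<le> ennreal (max 0 (f s) + max 0 (- b) + max 0 (- c) * s)"
    by (rule ennreal_leI)
  then show ?thesis using s
    by (simp add: ext0_def ennreal_mult ennreal_max_0)
qed

section \<open>Integrated affine bounds and tangents\<close>

text \<open>Multiply the pointwise bound by the indicator of \<open>W\<close> and integrate. Off
  \<open>W\<close> only \<open>F\<close> remains, on the larger side, so it may be integrated over
  the whole space.\<close>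

lemma nn_integral_affine_bound:
  assumes [measurable]: "D \<in> borel_measurable M" "F \<in> borel_measurable M" "W \<in> sets M"
    and le: "AE z in M. \<alpha> + \<beta> * D z \<le> F z + \<gamma> + \<delta> * D z"
  shows "\<alpha> * emeasure M W + \<beta> * (\<integral>\<^sup>+z\<in>W. D z \<partial>M)
    \<le> (\<integral>\<^sup>+z. F z \<partial>M) + \<gamma> * emeasure M W + \<delta> * (\<integral>\<^sup>+z\<in>W. D z \<partial>M)"
proof -
  have "\<alpha> * emeasure M W + \<beta> * (\<integral>\<^sup>+z\<in>W. D z \<partial>M)
      = (\<integral>\<^sup>+z. \<alpha> * indicator W z + \<beta> * (D z * indicator W z) \<partial>M)"
    by (simp add: nn_integral_add nn_integral_cmult)
  also have "\<dots> \<le> (\<integral>\<^sup>+z. F z + \<gamma> * indicator W z + \<delta> * (D z * indicator W z) \<partial>M)"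
    using le by (intro nn_integral_mono_AE) (auto split: split_indicator)
  also have "\<dots> = (\<integral>\<^sup>+z. F z \<partial>M) + \<gamma> * emeasure M W + \<delta> * (\<integral>\<^sup>+z\<in>W. D z \<partial>M)"
    by (simp add: nn_integral_add nn_integral_cmult)
  finally show ?thesis .
qed

lemma convex_on_affine_minorant:
  fixes f :: "real \<Rightarrow> real"
  assumes "convex_on {0<..} f" "0 < t"
  obtains b c where "f t = b + c * t" "\<And>s. 0 < s \<Longrightarrow> b + c * s \<le> f s"
proof -
  \<comment> \<open>The infimum of the chord slopes to the right of \<open>t\<close> is the right
    derivative of \<open>f\<close> at \<open>t\<close>.\<close>
  define c where "c = Inf ((\<lambda>s. (f t - f s) / (t - s)) ` ({t<..} \<inter> {0<..}))"
  have "f t + c * (s - t) \<le> f s" if "0 < s" for s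
    unfolding c_def using convex_le_Inf_differential[OF assms(1), of t s] assms(2) that
    by (auto simp: interior_open)
  then show thesis using that[of "f t - c * t" c] by (simp add: algebra_simps)
qed

section \<open>Behaviour of \<open>f\<close> near 0 under hypothesis (i)\<close>

text \<open>Compare \<open>x * f (1 / x)\<close> at \<open>x = 1\<close> and at
  \<open>x = 1 / s\<close>.\<close>

lemma antimono_perspective_le_linear:
  fixes f :: "real \<Rightarrow> real"
  assumes "antimono_on {0<..} (\<lambda>x. x * f (1 / x))" "0 < s" "s \<le> 1"
  shows "f s \<le> s * f 1"
  using monotone_onD[OF assms(1), of 1 "1 / s"] assms(2,3) by (auto simp: field_simps)

text \<open>The minorant lies below \<open>s * f 1\<close> for small \<open>s\<close>; let
  \<open>s\<close> tend to 0.\<close>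

lemma antimono_perspective_intercept_nonpos:
  fixes f :: "real \<Rightarrow> real"
  assumes "antimono_on {0<..} (\<lambda>x. x * f (1 / x))" "\<And>s. 0 < s \<Longrightarrow> b + c * s \<le> f s"
  shows "b \<le> 0"
proof (rule tendsto_upperbound)
  show "((\<lambda>s. b + c * s - s * f 1) \<longlongrightarrow> b) (at_right 0)"
    by (auto intro!: tendsto_eq_intros)
  show "\<forall>\<^sub>F s in at_right 0. b + c * s - s * f 1 \<le> 0"
    unfolding eventually_at_right_field
  proof (intro exI conjI allI impI)
    fix s :: real assume "0 < s" "s < 1"
    then show "b + c * s - s * f 1 \<le> 0"
      using antimono_perspective_le_linear[OF assms(1), of s] assms(2)[of s] by simp
  qed simp
qed simp

text \<open>The linear upper bound squeezes the limit. This settles the case \<open>Vopt = 0\<close>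
  under hypothesis (i).\<close>

lemma antimono_perspective_ext0_0:
  assumes "convex_on {0<..} f" "antimono_on {0<..} (\<lambda>x. x * f (1 / x))"
  shows "ext0 f 0 = 0"
proof -
  have "((\<lambda>s. ennreal (s * f 1)) \<longlongrightarrow> ennreal (0 * f 1)) (at_right 0)"
    by (intro tendsto_intros)
  moreover have "\<forall>\<^sub>F s in at_right 0. ennreal (f s) \<le> ennreal (s * f 1)"
    unfolding eventually_at_right_field
    by (auto intro!: exI[of _ 1] ennreal_leI antimono_perspective_le_linear[OF assms(2)])
  ultimately have "ext0 f 0 \<le> ennreal (0 * f 1)"
    using tendsto_le[OF _ _ tendsto_ext0_0[OF assms(1)]] by fastforce
  then show ?thesis by simp
qed

section \<open>Success sets of decision rules in the product space\<close>

theorem theorem4p7: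
  fixes P :: "'t measure" and \<nu> :: "'x measure" and \<mu> :: "'t \<Rightarrow> 'x measure"
    and A :: "'a measure" and I :: "'a \<Rightarrow> 't \<Rightarrow> real"
    and f :: "real \<Rightarrow> real" and D :: "'t \<Rightarrow> 'x \<Rightarrow> ennreal"
  assumes prior: "prob_space P"
    and fin_nu: "finite_measure \<nu>"
    and fin_mu: "\<And>\<theta>. \<theta> \<in> space P \<Longrightarrow> finite_measure (\<mu> \<theta>)"
    and sets_mu: "\<And>\<theta>. \<theta> \<in> space P \<Longrightarrow> sets (\<mu> \<theta>) = sets \<nu>"
    and I_01: "\<And>a \<theta>. a \<in> space A \<Longrightarrow> \<theta> \<in> space P \<Longrightarrow> I a \<theta> \<in> {0, 1}"
    and D_measurable: "(\<lambda>(\<theta>, x). D \<theta> x) \<in> borel_measurable (P \<Otimes>\<^sub>M \<nu>)"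
    and D_version: "\<And>\<theta>. \<theta> \<in> space P \<Longrightarrow> AE x in \<nu>. D \<theta> x = RN_deriv \<nu> (\<mu> \<theta>) x"
    and mu_measurable: "\<And>B. B \<in> sets \<nu> \<Longrightarrow> (\<lambda>\<theta>. emeasure (\<mu> \<theta>) B) \<in> borel_measurable P"
    and I_measurable: "\<And>d. d \<in> decision_rules \<nu> A \<Longrightarrow>
          (\<lambda>(\<theta>, x). I (d x) \<theta>) \<in> borel_measurable (P \<Otimes>\<^sub>M \<nu>)"
    and f_nonneg: "\<And>t. 0 < t \<Longrightarrow> 0 \<le> f t"
    and f_convex: "convex_on {0<..} f"
    and nu_le_1: "emeasure \<nu> (space \<nu>) \<le> 1"
    and mu_le_1: "(SUP \<theta>\<in>space P. emeasure (\<mu> \<theta>) (space (\<mu> \<theta>))) \<le> 1"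
    and ac: "\<And>\<theta>. \<theta> \<in> space P \<Longrightarrow> absolutely_continuous \<nu> (\<mu> \<theta>)"
    and cases: "antimono_on {0<..} (\<lambda>x. x * f (1 / x)) \<or> emeasure \<nu> (space \<nu>) = 1"
    and V0_pos: "0 < V0 P A I"
  shows "(\<integral>\<^sup>+\<theta>. (\<integral>\<^sup>+x. ext0 f (RN_deriv \<nu> (\<mu> \<theta>) x) \<partial>\<nu>) \<partial>P)
           \<ge> V0 P A I * ext0 f (Vopt P \<nu> \<mu> A I / V0 P A I)"
proof -
  interpret P: prob_space P by (rule prior)
  interpret N: finite_measure \<nu> by (rule fin_nu)
  interpret PN: pair_sigma_finite P \<nu> ..
  define M where "M = P \<Otimes>\<^sub>M \<nu>"
  define E where "E z = D (fst z) (snd z)" for z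
  define W where "W d = {z \<in> space M. I (d (snd z)) (fst z) = 1}" for d
  define p where "p d = emeasure M (W d)" for d
  define q where "q d = (\<integral>\<^sup>+z\<in>W d. E z \<partial>M)" for d
  define L where "L = (\<integral>\<^sup>+z. ext0 f (E z) \<partial>M)"
  let ?R = "decision_rules \<nu> A" and ?V = "V0 P A I" and ?O = "Vopt P \<nu> \<mu> A I"
  note [measurable] = borel_measurable_ext0[OF f_convex]
  have E_meas [measurable]: "E \<in> borel_measurable M"
    using D_measurable by (simp add: E_def[abs_def] M_def split_beta')
  have sp: "space M = space P \<times> space \<nu>" by (simp add: M_def space_pair_measure)
  have W_meas [measurable]: "W d \<in> sets M" if "d \<in> ?R" for d
  proof -
    have [measurable]: "(\<lambda>z. I (d (snd z)) (fst z)) \<in> borel_measurable M"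
      using I_measurable[OF that] by (simp add: M_def split_beta')
    show ?thesis unfolding W_def by measurable
  qed
  have fst_eq: "(\<integral>\<^sup>+z. g z \<partial>M) = (\<integral>\<^sup>+\<theta>. \<integral>\<^sup>+x. g (\<theta>, x) \<partial>\<nu> \<partial>P)" if "g \<in> borel_measurable M" for g
    using that unfolding M_def by (rule N.nn_integral_fst[symmetric])

  \<comment> \<open>\<open>RN_deriv\<close> is chosen separately for each \<open>\<theta>\<close>;
    replacing it by the jointly measurable version \<open>D\<close> turns the iterated integral into
    one over the product.\<close>
  have L_eq: "(\<integral>\<^sup>+\<theta>. (\<integral>\<^sup>+x. ext0 f (RN_deriv \<nu> (\<mu> \<theta>) x) \<partial>\<nu>) \<partial>P) = L"
    unfolding L_def
  proof (subst fst_eq, measurable, rule nn_integral_cong, rule nn_integral_cong_AE)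
    fix \<theta> assume "\<theta> \<in> space P"
    from D_version[OF this]
    show "AE x in \<nu>. ext0 f (RN_deriv \<nu> (\<mu> \<theta>) x) = ext0 f (E (\<theta>, x))"
      by eventually_elim (simp add: E_def)
  qed

  have mu_eq: "(\<integral>\<^sup>+x\<in>B. E (\<theta>, x) \<partial>\<nu>) = emeasure (\<mu> \<theta>) B"
    if "\<theta> \<in> space P" "B \<in> sets \<nu>" for \<theta> B
  proof -
    have "(\<integral>\<^sup>+x\<in>B. E (\<theta>, x) \<partial>\<nu>) = (\<integral>\<^sup>+x\<in>B. RN_deriv \<nu> (\<mu> \<theta>) x \<partial>\<nu>)"
      using D_version[OF that(1)] by (intro nn_integral_cong_AE) (auto simp: E_def)
    also have "\<dots> = emeasure (density \<nu> (RN_deriv \<nu> (\<mu> \<theta>))) B"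
      using that by (simp add: emeasure_density)
    finally show ?thesis
      using N.density_RN_deriv[OF ac sets_mu] that by simp
  qed
  \<comment> \<open>Integrating the density over each slice of \<open>W d\<close> gives the expected
    success mass of \<open>d\<close>, so \<open>Vopt\<close> is the supremum of
    \<open>q\<close>.\<close>
  have q_eq: "q d = (\<integral>\<^sup>+\<theta>. emeasure (\<mu> \<theta>) {x \<in> space \<nu>. I (d x) \<theta> = 1} \<partial>P)"
    if [measurable]: "d \<in> ?R" for d
    unfolding q_def
  proof (subst fst_eq, measurable, intro nn_integral_cong)
    fix \<theta> assume \<theta>: "\<theta> \<in> space P"
    have "{x \<in> space \<nu>. I (d x) \<theta> = 1} = Pair \<theta> -` W d"
      using \<theta> by (auto simp: W_def sp)
    also have "\<dots> \<in> sets \<nu>" using W_meas[OF that] unfolding M_def by (rule sets_Pair1)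
    finally have "(\<integral>\<^sup>+x\<in>{x \<in> space \<nu>. I (d x) \<theta> = 1}. E (\<theta>, x) \<partial>\<nu>)
        = emeasure (\<mu> \<theta>) {x \<in> space \<nu>. I (d x) \<theta> = 1}"
      by (rule mu_eq[OF \<theta>])
    then show "(\<integral>\<^sup>+x. E (\<theta>, x) * indicator (W d) (\<theta>, x) \<partial>\<nu>)
        = emeasure (\<mu> \<theta>) {x \<in> space \<nu>. I (d x) \<theta> = 1}"
      using \<theta> by (auto simp: W_def sp indicator_def cong: nn_integral_cong elim!: trans[rotated])
  qed
  have O_eq: "?O = (SUP d\<in>?R. q d)"
    by (simp add: Vopt_def q_eq cong: SUP_cong_simp)
  have q_le_O: "q d \<le> ?O" if "d \<in> ?R" for d
    unfolding O_eq using that by (rule SUP_upper)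
  have O_le: "?O \<le> (\<integral>\<^sup>+z. E z \<partial>M)"
    unfolding O_eq q_def by (intro SUP_least nn_integral_mono) (auto split: split_indicator)
  have "(\<integral>\<^sup>+z. E z \<partial>M) = (\<integral>\<^sup>+\<theta>. emeasure (\<mu> \<theta>) (space \<nu>) \<partial>P)"
    using mu_eq[OF _ sets.top] by (subst fst_eq) (auto cong: nn_integral_cong)
  also have "\<dots> \<le> (\<integral>\<^sup>+\<theta>. 1 \<partial>P)"
    using mu_le_1 sets_eq_imp_space_eq[OF sets_mu] by (intro nn_integral_mono) (auto simp: SUP_le_iff)
  also have "\<dots> = 1" by (simp add: P.emeasure_space_1)
  finally have E_le: "(\<integral>\<^sup>+z. E z \<partial>M) \<le> 1" .
  have E_fin: "AE z in M. E z \<noteq> \<top>"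
    using nn_integral_PInf_AE[OF E_meas] E_le by (fastforce simp: top_unique)

  \<comment> \<open>Slice at a fixed observation \<open>x\<close> instead: \<open>d x\<close> is
    then a single action, whose success probability is at most \<open>V0\<close>, and
    \<open>\<nu>\<close> has mass at most 1.\<close>
  have p_le: "p d \<le> ?V" if d: "d \<in> ?R" for d
  proof -
    have "p d = (\<integral>\<^sup>+x. emeasure P ((\<lambda>\<theta>. (\<theta>, x)) -` W d) \<partial>\<nu>)"
      unfolding p_def using W_meas[OF d] by (simp add: M_def PN.emeasure_pair_measure_alt2)
    also have "\<dots> \<le> (\<integral>\<^sup>+x. ?V \<partial>\<nu>)"
    proof (rule nn_integral_mono)
      fix x assume x: "x \<in> space \<nu>"
      then have "(\<lambda>\<theta>. (\<theta>, x)) -` W d = {\<theta> \<in> space P. I (d x) \<theta> = 1}" by (auto simp: W_def sp)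
      moreover have "d x \<in> space A" using d x by (auto simp: decision_rules_def measurable_space)
      ultimately show "emeasure P ((\<lambda>\<theta>. (\<theta>, x)) -` W d) \<le> ?V"
        unfolding V0_def by (auto intro: SUP_upper)
    qed
    also have "\<dots> \<le> ?V * 1"
      using nu_le_1 by (subst nn_integral_const) (intro mult_left_mono, auto)
    finally show ?thesis by simp
  qed
  have const: "(\<lambda>_. a) \<in> ?R" if "a \<in> space A" for a
    using that by (simp add: decision_rules_def)
  \<comment> \<open>For a constant rule all these slices coincide, so mass 1 of \<open>\<nu>\<close>
    gives equality.\<close>
  have p_const: "p (\<lambda>_. a) = emeasure P {\<theta> \<in> space P. I a \<theta> = 1}"
    if a: "a \<in> space A" and "emeasure \<nu> (space \<nu>) = 1" for a
  proof -
    have "emeasure P ((\<lambda>\<theta>. (\<theta>, x)) -` W (\<lambda>_. a)) = emeasure P {\<theta> \<in> space P. I a \<theta> = 1}"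
      if "x \<in> space \<nu>" for x
      using that by (intro arg_cong[where f = "emeasure P"]) (auto simp: W_def sp)
    then show ?thesis unfolding p_def
      using W_meas[OF const[OF a]] that by (simp add: M_def PN.emeasure_pair_measure_alt2 cong: nn_integral_cong)
  qed
  have V_eq: "?V = (SUP a\<in>space A. p (\<lambda>_. a))" if "emeasure \<nu> (space \<nu>) = 1"
    using that by (simp add: V0_def p_const cong: SUP_cong_simp)

  have V_le: "?V \<le> 1" unfolding V0_def by (auto intro!: SUP_least P.emeasure_le_1)
  obtain v where V: "?V = ennreal v" "0 < v" "v \<le> 1"
    using V_le V0_pos by (cases ?V rule: ennreal_cases) (auto simp: top_unique)
  have "?O \<le> 1" using O_le E_le by (rule order_trans)
  then obtain w where O: "?O = ennreal w" "0 \<le> w"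
    by (cases ?O rule: ennreal_cases) (auto simp: top_unique)

  show ?thesis
  proof (cases "w = 0")
    \<comment> \<open>The tangent point would be 0, where \<open>ext0 f\<close> may be infinite or
      have infinite slope, so this case avoids tangents.\<close>
    case True
    have "?V * ext0 f 0 \<le> L"
      using cases
    proof
      assume "antimono_on {0<..} (\<lambda>x. x * f (1 / x))"
      then show ?thesis using antimono_perspective_ext0_0[OF f_convex] by simp
    next
      assume nu: "emeasure \<nu> (space \<nu>) = 1"
      have "p (\<lambda>_. a) * ext0 f 0 \<le> L" if a: "a \<in> space A" for a
      proof -
        \<comment> \<open>An infinite slope forces the affine bound to hold wherever the density is non-zero.\<close>
        have "ext0 f 0 + 0 * E z \<le> ext0 f (E z) + 0 + \<top> * E z" for z
          by (cases "E z = 0") (auto simp: ennreal_top_mult)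
        from nn_integral_affine_bound[OF E_meas _ W_meas[OF const[OF a]] AE_I2[OF this]]
        have "ext0 f 0 * p (\<lambda>_. a) \<le> L + \<top> * q (\<lambda>_. a)"
          by (simp add: p_def q_def L_def)
        \<comment> \<open>In \<open>ennreal\<close>, \<open>\<top> * 0 = 0\<close>, so the term with
          infinite slope vanishes.\<close>
        moreover have "q (\<lambda>_. a) = 0"
          using q_le_O[OF const[OF a]] O True by simp
        ultimately show ?thesis by (simp add: mult.commute)
      qed
      then show ?thesis
        unfolding V_eq[OF nu] SUP_mult_right_ennreal by (rule SUP_least)
    qed
    then show ?thesis using O True by (simp add: L_eq)
  next
    case False
    define t where "t = w / v"
    have t: "0 < t" "?O / ?V = ennreal t" "v * t = w"
      using V O False by (auto simp: t_def divide_ennreal)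
    obtain b c where bc: "f t = b + c * t" "\<And>s. 0 < s \<Longrightarrow> b + c * s \<le> f s"
      using convex_on_affine_minorant[OF f_convex \<open>0 < t\<close>] by blast
    \<comment> \<open>The tangent touches \<open>f\<close> at \<open>t = w / v\<close>, which makes
      the target value linear in \<open>v\<close> and \<open>w\<close>.\<close>
    have "v * f t = b * v + c * (v * t)" unfolding bc(1) by (simp add: algebra_simps)
    moreover have "0 \<le> v * f t" using t(1) V f_nonneg by simp
    ultimately have vf: "v * f t = b * v + c * w" "0 \<le> v * f t" by (auto simp: t(3))
    \<comment> \<open>Negative parts of the coefficients stand on the right, which avoids
      subtraction in \<open>ennreal\<close>.\<close>
    have key: "ennreal b * emeasure M B + ennreal c * (\<integral>\<^sup>+z\<in>B. E z \<partial>M)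
        \<le> L + ennreal (- b) * emeasure M B + ennreal (- c) * (\<integral>\<^sup>+z\<in>B. E z \<partial>M)"
      if "B \<in> sets M" for B
      unfolding L_def using E_fin that
      by (intro nn_integral_affine_bound) (auto intro: affine_le_ext0[OF f_convex bc(2)] elim!: eventually_mono)
    have key_d: "ennreal b * p d + ennreal c * q d \<le> L + ennreal (- b) * p d + ennreal (- c) * q d"
      if "d \<in> ?R" for d
      using key[OF W_meas[OF that]] by (simp add: p_def q_def)
    have "ennreal (v * f t) \<le> L"
    proof -
      consider "b \<le> 0" | "0 < b" "0 \<le> c" "emeasure \<nu> (space \<nu>) = 1"
        | "0 < b" "c < 0" "emeasure \<nu> (space \<nu>) = 1"
        using cases antimono_perspective_intercept_nonpos[of f b c] bc(2) by force
      then show ?thesis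
      proof cases
        case 1
        \<comment> \<open>Here \<open>c * t = f t - b\<close> is non-negative and \<open>t\<close>
          is positive.\<close>
        have c: "0 \<le> c"
          using bc(1) f_nonneg[OF \<open>0 < t\<close>] 1 t(1) by (smt (verit) mult_neg_pos)
        have "ennreal c * q d \<le> L + ennreal (- b) * ?V" if "d \<in> ?R" for d
        proof -
          have "ennreal c * q d \<le> L + ennreal (- b) * p d"
            using key_d[OF that] 1 c by (simp add: ennreal_neg)
          also have "\<dots> \<le> L + ennreal (- b) * ?V"
            using p_le[OF that] by (intro add_left_mono mult_left_mono) auto
          finally show ?thesis .
        qed
        then have "ennreal c * ?O \<le> L + ennreal (- b) * ?V"
          unfolding O_eq SUP_mult_left_ennreal by (rule SUP_least)
        \<comment> \<open>Both summands are non-negative reals, so \<open>ennreal\<close> is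
          additive on them, and the first, being finite, can be cancelled below.\<close>
        moreover have "ennreal c * ?O = ennreal (- b * v) + ennreal (v * f t)"
        proof -
          have "ennreal c * ?O = ennreal (- b * v + v * f t)"
            using O c vf by (simp add: ennreal_mult[symmetric])
          also have "\<dots> = ennreal (- b * v) + ennreal (v * f t)"
            using 1 V vf by (intro ennreal_plus) (auto simp: mult_nonpos_nonneg)
          finally show ?thesis .
        qed
        moreover have "ennreal (- b) * ?V = ennreal (- b * v)"
          using 1 V by (subst V) (simp flip: ennreal_mult)
        ultimately have "ennreal (- b * v) + ennreal (v * f t) \<le> ennreal (- b * v) + L"
          by (simp add: add.commute)
        then show ?thesis by (subst (asm) ennreal_add_left_cancel_le) auto
      next
        case 2
        have "emeasure M (space M) = 1"
          unfolding sp unfolding M_def using 2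
          by (subst N.emeasure_pair_measure_Times) (auto simp: P.emeasure_space_1)
        then have "ennreal b + ennreal c * (\<integral>\<^sup>+z\<in>space M. E z \<partial>M) \<le> L"
          using key[OF sets.top] 2 by (simp add: ennreal_neg)
        moreover have "(\<integral>\<^sup>+z\<in>space M. E z \<partial>M) = (\<integral>\<^sup>+z. E z \<partial>M)"
          by (intro nn_integral_cong) simp
        moreover have "ennreal (v * f t) \<le> ennreal b + ennreal c * ?O"
        proof -
          \<comment> \<open>This is where \<open>V0\<close> is at most 1, the mass of the whole
            product space.\<close>
          have "b * v \<le> b" using V 2 by simp
          then show ?thesis using 2 O vf
            by (simp add: ennreal_mult[symmetric] ennreal_plus[symmetric] ennreal_leI del: ennreal_plus)
        qed
        moreover have "ennreal b + ennreal c * ?O \<le> ennreal b + ennreal c * (\<integral>\<^sup>+z. E z \<partial>M)"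
          using O_le by (intro add_left_mono mult_left_mono) auto
        ultimately show ?thesis by (metis order_trans)
      next
        case 3
        have "ennreal b * p (\<lambda>_. a) \<le> L + ennreal (- c) * ?O" if a: "a \<in> space A" for a
        proof -
          have "ennreal b * p (\<lambda>_. a) \<le> L + ennreal (- c) * q (\<lambda>_. a)"
            using key_d[OF const[OF a]] 3 by (simp add: ennreal_neg)
          also have "\<dots> \<le> L + ennreal (- c) * ?O"
            using q_le_O[OF const[OF a]] by (intro add_left_mono mult_left_mono) auto
          finally show ?thesis .
        qed
        then have "ennreal b * ?V \<le> L + ennreal (- c) * ?O"
          unfolding V_eq[OF 3(3)] SUP_mult_left_ennreal by (rule SUP_least)
        moreover have "ennreal b * ?V = ennreal (- c * w) + ennreal (v * f t)"
        proof -
          have "ennreal b * ?V = ennreal (- c * w + v * f t)"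
            using V 3 vf by (simp add: ennreal_mult[symmetric])
          also have "\<dots> = ennreal (- c * w) + ennreal (v * f t)"
            using 3 O vf by (intro ennreal_plus) (auto simp: mult_nonpos_nonneg)
          finally show ?thesis .
        qed
        moreover have "ennreal (- c) * ?O = ennreal (- c * w)"
          using 3 O by (subst O) (simp flip: ennreal_mult)
        ultimately have "ennreal (- c * w) + ennreal (v * f t) \<le> ennreal (- c * w) + L"
          by (simp add: add.commute)
        then show ?thesis by (subst (asm) ennreal_add_left_cancel_le) auto
      qed
    qed
    moreover have "?V * ext0 f (?O / ?V) = ennreal (v * f t)"
      using t V f_nonneg[of t] by (simp add: ext0_def ennreal_mult)
    ultimately show ?thesis by (simp add: L_eq)
  qed
qed

end
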